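(* Let $X$ be a topological space with the property $BP_3'$ in which there is a closed nowhere dense set $F\subset X$ which is homeomorphic with the Cantor set. Then there exists a $\mathfrak c$-generated free algebra (over $\mathbb R$, with pointwise operations) contained in the family of all non-Borel super quasi-continuous functions from $X$ to $\mathbb R$ plus the zero function.
   Context: $\mathbb N=\{0,1,2,\dots\}$ and $\mathfrak c=2^{\aleph_0}$. Property $BP_3'$: a topological space $X$ has property $BP_3'$ if for every nowhere dense set $F\subset X$ there is a sequence $(U_m)_{m\in\mathbb N}$ of pairwise disjoint non-empty open sets such that (i') $U_m\cap F=\emptyset$ for all $m\in\mathbb N$; (ii') $F\subset\mathrm{cl}(U_m)$ for each $m\in\mathbb N$; (iii') $X\setminus(F\cup\bigcup_{m>0}U_m)\subset\mathrm{cl}(U_0)$. A function $f\colon X\to Y$ between topological spaces is super quasi-continuous if for each $x_0\in X$, each neighbourhood $W$ of $x_0$ and each neighbourhood $V$ of $f(x_0)$ there is $x\in C_f\cap W$ with $f(x)\in V$, where $C_f$ is the set of continuity points of $f$. A function is non-Borel if it is not Borel measurable, i.e. the preimage of some open set is not a Borel set. A $\kappa$-generated free algebra here is a (not necessarily unital) subalgebra $\mathfrak B$ of the algebra of all functions, generated by a set $S$ with $|S|=\kappa$ of free generators: for any $n$, any polynomial $P$ in $n$ variables without constant term and any pairwise different $x_1,\dots,x_n\in S$, $P(x_1,\dots,x_n)=0$ iff $P=0$. *)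

theory Defs
  imports "HOL-Analysis.Analysis" "HOL-Library.Equipollence" "HOL-Library.Poly_Mapping"
begin

definition nowhere_dense :: "'a::topological_space set \<Rightarrow> bool" where
  "nowhere_dense F \<longleftrightarrow> interior (closure F) = {}"

definition BP3' :: "'a::topological_space itself \<Rightarrow> bool" where
  "BP3' (_ :: 'a itself) \<longleftrightarrow>
     (\<forall>F :: 'a set. nowhere_dense F \<longrightarrow>
       (\<exists>U :: nat \<Rightarrow> 'a set.
          disjoint_family U \<and> (\<forall>m. open (U m) \<and> U m \<noteq> {}) \<and>
          (\<forall>m. U m \<inter> F = {}) \<and>
          (\<forall>m. F \<subseteq> closure (U m)) \<and>
          UNIV - (F \<union> (\<Union>m\<in>{0<..}. U m)) \<subseteq> closure (U 0)))"

text \<open>The stages of the middle-thirds construction; the Cantor set is their intersection.\<close>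

primrec cantor_stage :: "nat \<Rightarrow> real set" where
  "cantor_stage 0 = {0..1}"
| "cantor_stage (Suc n) =
     (\<lambda>x. x / 3) ` cantor_stage n \<union> (\<lambda>x. 2 / 3 + x / 3) ` cantor_stage n"

definition cantor_set :: "real set" where
  "cantor_set = (\<Inter>n. cantor_stage n)"

text \<open>The library constant \<open>isCont\<close> requires a Hausdorff domain, so continuity at a point is
  expressed by the underlying limit.\<close>

definition continuity_points ::
    "('a::topological_space \<Rightarrow> 'b::topological_space) \<Rightarrow> 'a set" where
  "continuity_points f = {x. (f \<longlongrightarrow> f x) (at x)}"

definition super_quasi_continuous ::
    "('a::topological_space \<Rightarrow> 'b::topological_space) \<Rightarrow> bool" where
  "super_quasi_continuous f \<longleftrightarrow>
     (\<forall>x0 W V. open W \<and> x0 \<in> W \<and> open V \<and> f x0 \<in> V \<longrightarrow>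
        (\<exists>x \<in> continuity_points f \<inter> W. f x \<in> V))"

definition fun_subalgebra :: "('a \<Rightarrow> real) set \<Rightarrow> bool" where
  "fun_subalgebra B \<longleftrightarrow>
     (\<lambda>x. 0) \<in> B \<and>
     (\<forall>f\<in>B. \<forall>g\<in>B. (\<lambda>x. f x + g x) \<in> B) \<and>
     (\<forall>f\<in>B. \<forall>g\<in>B. (\<lambda>x. f x * g x) \<in> B) \<and>
     (\<forall>c. \<forall>f\<in>B. (\<lambda>x. c * f x) \<in> B)"

text \<open>A real polynomial maps monomials to coefficients, a monomial maps variable indices to
  exponents, both with finite support. The constant term is the coefficient of the monomial \<open>0\<close>.\<close>

type_synonym real_mpoly = "(nat \<Rightarrow>\<^sub>0 nat) \<Rightarrow>\<^sub>0 real"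

definition poly_in_vars :: "nat \<Rightarrow> real_mpoly \<Rightarrow> bool" where
  "poly_in_vars n P \<longleftrightarrow> (\<forall>m \<in> Poly_Mapping.keys P. Poly_Mapping.keys m \<subseteq> {..<n})"

definition poly_at_funs :: "real_mpoly \<Rightarrow> (nat \<Rightarrow> 'a \<Rightarrow> real) \<Rightarrow> 'a \<Rightarrow> real" where
  "poly_at_funs P f = (\<lambda>t. \<Sum>m\<in>Poly_Mapping.keys P.
     Poly_Mapping.lookup P m *
     (\<Prod>i\<in>Poly_Mapping.keys m. f i t ^ Poly_Mapping.lookup m i))"

definition free_generators :: "('a \<Rightarrow> real) set \<Rightarrow> bool" where
  "free_generators S \<longleftrightarrow>
     (\<forall>n P f. poly_in_vars n P \<and> Poly_Mapping.lookup P 0 = 0 \<and>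
        inj_on f {..<n} \<and> f ` {..<n} \<subseteq> S \<longrightarrow>
        (poly_at_funs P f = (\<lambda>t. 0) \<longleftrightarrow> P = 0))"

text \<open>The cardinal number of generators is given as the cardinality of the set \<open>K\<close>.\<close>

definition generated_free_algebra :: "'k set \<Rightarrow> ('a \<Rightarrow> real) set \<Rightarrow> bool" where
  "generated_free_algebra K B \<longleftrightarrow>
     (\<exists>S. S \<approx> K \<and> free_generators S \<and> B = fun_subalgebra hull S)"

end

theory Submission
  imports Defs
begin

text \<open>The power of the real line with exponent the continuum is separable; let \<open>q\<close> enumerate a
  dense sequence. A map \<open>G\<close> from the space into this power is \<open>q m\<close> on \<open>U m\<close> for \<open>m > 0\<close>, \<open>q 0\<close> on
  the rest of the complement of \<open>F\<close>, and takes values among \<open>0\<close> and the \<open>q m\<close> on \<open>F\<close>. As every \<open>U m\<close>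
  accumulates at every point of \<open>F\<close>, each \<open>p \<circ> G\<close> with \<open>p\<close> continuous is super quasi-continuous.

  There are only continuum many pairs of a Borel set \<open>B\<close> and an index \<open>m\<close>, hence every pair can be
  attached to some point \<open>t\<close> of \<open>F\<close>. Put \<open>G t = 0\<close> if \<open>t \<in> B\<close> and \<open>G t = q m\<close> otherwise. If \<open>p\<close> is
  continuous, \<open>p 0 = 0\<close> and \<open>p \<noteq> 0\<close>, then \<open>p (q m) \<noteq> 0\<close> for some \<open>m\<close>, so the set where \<open>p \<circ> G\<close> does
  not vanish differs from every Borel set. The coordinates of \<open>G\<close> are the free generators.\<close>

section \<open>Cardinalities\<close>

datatype borel_code = Base nat | Nor "nat \<Rightarrow> borel_code"

text \<open>One operation suffices: \<open>Nor\<close> on a constant family is a complement, and two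
  nested uses of \<open>Nor\<close> give a countable union.\<close>

primrec borel_code_set :: "'a set \<Rightarrow> (nat \<Rightarrow> 'a set) \<Rightarrow> borel_code \<Rightarrow> 'a set" where
  "borel_code_set \<Omega> b (Base n) = b n"
| "borel_code_set \<Omega> b (Nor f) = \<Omega> - (\<Union>i. borel_code_set \<Omega> b (f i))"

text \<open>A code is a well-founded tree, determined by its labels at the nodes of the full tree
  \<open>nat list\<close>; the label \<open>0\<close> marks inner nodes and positions outside the tree.\<close>

primrec borel_code_label :: "borel_code \<Rightarrow> nat list \<Rightarrow> nat" where
  "borel_code_label (Base n) p = (if p = [] then Suc n else 0)"
| "borel_code_label (Nor f) p = (case p of [] \<Rightarrow> 0 | k # p' \<Rightarrow> borel_code_label (f k) p')"

text \<open>The root label separates \<open>Base\<close> from \<open>Nor\<close>, and the labels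
  along paths starting with \<open>k\<close> are those of the \<open>k\<close>-th subtree, so
  structural induction applies.\<close>

lemma borel_code_label_inj: "borel_code_label c = borel_code_label d \<Longrightarrow> c = d"
proof (induction c arbitrary: d)
  case (Base n)
  from fun_cong[OF Base, of "[]"] show ?case by (cases d) auto
next
  case (Nor f)
  show ?case
  proof (cases d)
    case (Base n)
    with fun_cong[OF Nor.prems, of "[]"] show ?thesis by simp
  next
    case d: (Nor g)
    have "borel_code_label (f k) = borel_code_label (g k)" for k
      using fun_cong[OF Nor.prems, of "k # _"] by (auto simp: d)
    then have "f k = g k" for k
      using Nor.IH by blast
    then show ?thesis by (auto simp: d)
  qed
qed

text \<open>A function between countable types is determined by its graph, which
  \<open>to_nat\<close> turns into a set of naturals.\<close>

lemma inj_imp_lepoll_nat_sets: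
  fixes f :: "'a \<Rightarrow> ('b::countable \<Rightarrow> 'c::countable)"
  assumes "inj_on f A"
  shows "A \<lesssim> (UNIV :: nat set set)"
proof -
  define e where "e x = to_nat ` range (\<lambda>p. (p, f x p))" for x
  have "f x = f y" if "e x = e y" for x y
  proof (rule ext)
    fix p
    have eq: "range (\<lambda>p. (p, f x p)) = range (\<lambda>p. (p, f y p))"
      using that unfolding e_def inj_image_eq_iff[OF inj_to_nat] .
    have "(p, f x p) \<in> range (\<lambda>p. (p, f y p))"
      unfolding eq[symmetric] by (rule rangeI)
    then show "f x p = f y p" by (elim rangeE) simp
  qed
  then have "inj_on e A"
    using assms unfolding inj_on_def by metis
  then show ?thesis unfolding lepoll_def by blast
qed

lemma sigma_sets_lepoll_nat_sets:
  assumes "countable G" "G \<subseteq> Pow \<Omega>"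
  shows "sigma_sets \<Omega> G \<lesssim> (UNIV :: nat set set)"
proof -
  \<comment> \<open>Inserting the empty set makes the family nonempty, hence enumerable, and gives
    the empty set a code.\<close>
  define b where "b = from_nat_into (insert {} G)"
  have b: "range b = insert {} G"
    using assms unfolding b_def by (intro range_from_nat_into) auto
  have "A \<in> range (borel_code_set \<Omega> b)" if "A \<in> sigma_sets \<Omega> G" for A
    using that
  proof (induction rule: sigma_sets.induct)
    case (Basic A)
    then obtain n where "A = b n" using b by blast
    then have "A = borel_code_set \<Omega> b (Base n)" by simp
    then show ?case by blast
  next
    case Empty
    then obtain n where "{} = b n" using b by blast
    then have "{} = borel_code_set \<Omega> b (Base n)" by simp
    then show ?case by blast
  next
    case (Compl A)
    then obtain c where "A = borel_code_set \<Omega> b c" by blast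
    then have "\<Omega> - A = borel_code_set \<Omega> b (Nor (\<lambda>_. c))" by simp
    then show ?case by blast
  next
    case (Union A)
    then have "\<forall>i. \<exists>c. A i = borel_code_set \<Omega> b c" by blast
    then obtain c where c: "\<And>i. A i = borel_code_set \<Omega> b (c i)" by metis
    \<comment> \<open>The inclusion lets the double complement relative to \<open>\<Omega>\<close>
      return the union unchanged.\<close>
    have "A i \<subseteq> \<Omega>" for i
      using sigma_sets_into_sp[OF assms(2) Union.hyps] by simp
    then have "(\<Union>i. A i) = borel_code_set \<Omega> b (Nor (\<lambda>_. Nor c))"
      by (auto simp: c)
    then show ?case by blast
  qed
  then have "sigma_sets \<Omega> G \<lesssim> (UNIV :: borel_code set)"
    by (auto simp: lepoll_iff)
  also have "(UNIV :: borel_code set) \<lesssim> (UNIV :: nat set set)"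
    by (rule inj_imp_lepoll_nat_sets[of borel_code_label])
       (auto simp: inj_on_def borel_code_label_inj)
  finally show ?thesis .
qed

text \<open>Bounds the number of pairs to be diagonalised against. A countable base generates the
  Borel sets, and two sets of naturals merge into one sequence of pairs of truth values.\<close>

lemma borel_sets_times_nat_lepoll_nat_sets:
  "sets (borel :: 'b::second_countable_topology measure) \<times> (UNIV :: nat set)
     \<lesssim> (UNIV :: nat set set)"
proof -
  obtain G :: "'b set set" where G: "countable G" "topological_basis G"
    using ex_countable_basis by blast
  have "sets (borel :: 'b measure) = sigma_sets UNIV G"
    by (simp add: borel_eq_countable_basis[OF G])
  with sigma_sets_lepoll_nat_sets[OF G(1), of UNIV]
  have borel: "sets (borel :: 'b measure) \<lesssim> (UNIV :: nat set set)" by simp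
  have nat: "(UNIV :: nat set) \<lesssim> (UNIV :: nat set set)"
    by (rule inj_imp_lepoll_nat_sets[of "\<lambda>n (_ :: nat). n"]) (auto simp: inj_on_def fun_eq_iff)
  have "inj (\<lambda>(A, B) (n :: nat). (n \<in> A, n \<in> B) :: bool \<times> bool)"
    by (auto simp: inj_on_def fun_eq_iff)
  then have "(UNIV :: nat set set) \<times> (UNIV :: nat set set) \<lesssim> (UNIV :: nat set set)"
    unfolding UNIV_Times_UNIV
    by (rule inj_imp_lepoll_nat_sets)
  then show ?thesis
    using lepoll_trans times_lepoll_mono[OF borel nat] by blast
qed

section \<open>Sets of naturals as ternary expansions with digits 0 and 2\<close>

definition cantor_point :: "nat set \<Rightarrow> real" where
  "cantor_point A = suminf (\<lambda>n. (if n \<in> A then 2 else 0) / 3 ^ Suc n)"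

lemma cantor_point_sums:
  "(\<lambda>n. (if n \<in> A then 2 else 0) / 3 ^ Suc n) sums cantor_point A"
proof -
  have "summable (\<lambda>n. 2 / 3 * (1 / 3 :: real) ^ n)"
    by (intro summable_mult summable_geometric) simp
  then have "summable (\<lambda>n. (if n \<in> A then 2 else 0) / (3::real) ^ Suc n)"
    by (rule summable_comparison_test[rotated]) (auto simp: power_divide)
  then show ?thesis
    unfolding cantor_point_def by (rule summable_sums)
qed

lemma cantor_point_bounds: "0 \<le> cantor_point A" "cantor_point A \<le> 1"
proof -
  show "0 \<le> cantor_point A"
    by (rule sums_le[OF _ sums_zero cantor_point_sums[of A]]) simp
  have "(\<lambda>n. 2 / 3 * (1 / 3 :: real) ^ n) sums (2 / 3 * (1 / (1 - 1 / 3)))"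
    by (intro sums_mult geometric_sums) simp
  then have "(\<lambda>n. 2 / 3 * (1 / 3 :: real) ^ n) sums 1" by simp
  with cantor_point_sums[of A] show "cantor_point A \<le> 1"
    by (rule sums_le[rotated]) (auto simp: power_divide)
qed

text \<open>Splits off the first ternary digit. The two cases match the two maps in
  \<open>cantor_stage (Suc n)\<close>, which drives the inductions below.\<close>

lemma cantor_point_shift:
  "cantor_point A = (if 0 \<in> A then 2 / 3 else 0) + cantor_point {n. Suc n \<in> A} / 3"
proof -
  let ?a = "\<lambda>A n. (if n \<in> A then 2 else 0) / (3::real) ^ Suc n"
  have "(\<lambda>n. ?a {n. Suc n \<in> A} n / 3) sums (cantor_point {n. Suc n \<in> A} / 3)"
    by (intro sums_divide cantor_point_sums)
  then have "(\<lambda>n. ?a A (Suc n)) sums (cantor_point {n. Suc n \<in> A} / 3)"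
    by (simp add: mult.commute)
  then have "?a A sums (cantor_point {n. Suc n \<in> A} / 3 + ?a A 0)"
    by (rule sums_Suc_iff[THEN iffD1, rotated])
  then show ?thesis
    using sums_unique2[OF cantor_point_sums[of A]] by auto
qed

lemma cantor_point_in_cantor_set: "cantor_point A \<in> cantor_set"
proof -
  have "cantor_point A \<in> cantor_stage n" for n
  proof (induction n arbitrary: A)
    case 0
    then show ?case by (simp add: cantor_point_bounds)
  next
    case (Suc n)
    from Suc[of "{n. Suc n \<in> A}"] show ?case
      by (subst cantor_point_shift) auto
  qed
  then show ?thesis by (simp add: cantor_set_def)
qed

text \<open>The first digit can be read off because the remainder is at most 1/3 while the digit
  contributes 0 or 2/3; later digits follow by shifting.\<close>

lemma cantor_point_inj: "inj cantor_point"
proof (rule injI)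
  fix A B :: "nat set"
  have "n \<in> A \<longleftrightarrow> n \<in> B" if "cantor_point A = cantor_point B" for n A B
    using that
  proof (induction n arbitrary: A B)
    case 0
    with cantor_point_shift[of A] cantor_point_shift[of B]
      cantor_point_bounds[of "{n. Suc n \<in> A}"] cantor_point_bounds[of "{n. Suc n \<in> B}"]
    show ?case by (auto split: if_splits)
  next
    case (Suc n)
    with cantor_point_shift[of A] cantor_point_shift[of B]
      cantor_point_bounds[of "{n. Suc n \<in> A}"] cantor_point_bounds[of "{n. Suc n \<in> B}"]
    have "cantor_point {n. Suc n \<in> A} = cantor_point {n. Suc n \<in> B}"
      by (auto split: if_splits)
    from Suc.IH[OF this] show ?case by simp
  qed
  then show "cantor_point A = cantor_point B \<Longrightarrow> A = B" by blast
qed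

lemma nat_sets_lepoll_cantor_set: "(UNIV :: nat set set) \<lesssim> cantor_set"
  unfolding lepoll_def
  by (rule exI[of _ cantor_point]) (simp add: cantor_point_inj cantor_point_in_cantor_set image_subset_iff)


section \<open>Separability of a power of the line and nonzero values of polynomials\<close>

text \<open>An instance of the Hewitt-Marczewski-Pondiczery theorem. A basic open set restricts
  finitely many indices, and these already differ below some \<open>k\<close>; so rational values
  prescribed on initial segments of length \<open>k\<close> reach it.\<close>

lemma separable_real_power_nat_sets:
  obtains q :: "nat \<Rightarrow> nat set \<Rightarrow> real"
  where "\<And>Z. open Z \<Longrightarrow> Z \<noteq> {} \<Longrightarrow> \<exists>m. q m \<in> Z"
proof -
  \<comment> \<open>\<open>r k \<alpha>\<close> is the word of the first \<open>k\<close> membership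
    bits of \<open>\<alpha>\<close>. \<open>h\<close> looks this word up in a finite table of
    rationals, with default 0; its arguments form a countable type.\<close>
  define r where "r k \<alpha> = map (\<lambda>i. i \<in> \<alpha>) [0..<k]" for k :: nat and \<alpha> :: "nat set"
  define h :: "nat \<times> (bool list \<times> rat) list \<Rightarrow> nat set \<Rightarrow> real"
    where "h = (\<lambda>(k, \<phi>) \<alpha>. case map_of \<phi> (r k \<alpha>) of None \<Rightarrow> 0 | Some c \<Rightarrow> of_rat c)"
  have "\<exists>z. h z \<in> Z" if Z: "open Z" "Z \<noteq> {}" for Z
  proof -
    obtain v where "v \<in> Z" using Z by blast
    have "openin (product_topology (\<lambda>i. euclidean) UNIV) Z"
      using Z by (simp add: open_fun_def)
    from product_topology_open_contains_basis[OF this \<open>v \<in> Z\<close>]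
    obtain X where vX: "v \<in> (\<Pi>\<^sub>E i\<in>UNIV. X i)" and X: "\<And>i. open (X i)"
      and fin: "finite {i. X i \<noteq> UNIV}" and XZ: "(\<Pi>\<^sub>E i\<in>UNIV. X i) \<subseteq> Z"
      by auto
    define I where "I = {i. X i \<noteq> UNIV}"
    have "\<exists>c. of_rat c \<in> X i" for i
    proof -
      have "v i \<in> X i" using PiE_mem[OF vX] by simp
      then obtain e where "e > 0" "ball (v i) e \<subseteq> X i"
        using X openE by blast
      moreover obtain c where "v i < of_rat c" "of_rat c < v i + e"
        using of_rat_dense[of "v i" "v i + e"] \<open>e > 0\<close> by auto
      ultimately show ?thesis
        by (auto simp: dist_real_def subset_iff intro!: exI[of _ c])
    qed
    then obtain c where c: "\<And>i. of_rat (c i) \<in> X i" by metis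
    have "\<exists>k. inj_on (r k) I"
    proof -
      \<comment> \<open>\<open>d \<alpha> \<beta>\<close> is the least number separating two
        distinct sets; its finitely many values on \<open>I \<times> I\<close> have a strict bound
        \<open>k\<close>. For equal sets the value is arbitrary and harmless.\<close>
      define d where "d \<alpha> \<beta> = (LEAST i. (i \<in> \<alpha>) \<noteq> (i \<in> \<beta>))" for \<alpha> \<beta> :: "nat set"
      have d: "(d \<alpha> \<beta> \<in> \<alpha>) \<noteq> (d \<alpha> \<beta> \<in> \<beta>)" if "\<alpha> \<noteq> \<beta>" for \<alpha> \<beta>
        using that LeastI_ex[of "\<lambda>i. (i \<in> \<alpha>) \<noteq> (i \<in> \<beta>)"] unfolding d_def by blast
      have "finite ((\<lambda>(\<alpha>, \<beta>). d \<alpha> \<beta>) ` (I \<times> I))"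
        using fin unfolding I_def by blast
      then obtain k where k: "\<And>i. i \<in> (\<lambda>(\<alpha>, \<beta>). d \<alpha> \<beta>) ` (I \<times> I) \<Longrightarrow> i < k"
        using finite_nat_set_iff_bounded by metis
      have "\<alpha> = \<beta>" if "\<alpha> \<in> I" "\<beta> \<in> I" "r k \<alpha> = r k \<beta>" for \<alpha> \<beta>
      proof (rule ccontr)
        assume "\<alpha> \<noteq> \<beta>"
        have "d \<alpha> \<beta> < k" using k that by force
        with that(3) have "(d \<alpha> \<beta> \<in> \<alpha>) = (d \<alpha> \<beta> \<in> \<beta>)"
          by (auto simp: r_def)
        with d[OF \<open>\<alpha> \<noteq> \<beta>\<close>] show False by simp
      qed
      then show ?thesis by (auto simp: inj_on_def)
    qed
    then obtain k where k: "inj_on (r k) I" by blast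
    obtain xs where xs: "set xs = I" "distinct xs"
      using fin finite_distinct_list unfolding I_def by blast
    define \<phi> where "\<phi> = map (\<lambda>i. (r k i, c i)) xs"
    have "map_of \<phi> (r k i) = Some (c i)" if "i \<in> I" for i
    proof (rule map_of_is_SomeI)
      show "distinct (map fst \<phi>)"
        using xs k by (simp add: \<phi>_def distinct_map o_def)
      show "(r k i, c i) \<in> set \<phi>"
        using that xs by (auto simp: \<phi>_def)
    qed
    then have "h (k, \<phi>) i \<in> X i" if "i \<in> I" for i
      using that c by (simp add: h_def)
    moreover have "X i = UNIV" if "i \<notin> I" for i
      using that by (simp add: I_def)
    ultimately have "h (k, \<phi>) i \<in> X i" for i
      by (cases "i \<in> I") auto
    then have "h (k, \<phi>) \<in> (\<Pi>\<^sub>E i\<in>UNIV. X i)"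
      by (simp add: PiE_iff)
    then show ?thesis using XZ by blast
  qed
  have "\<exists>m. h (from_nat m) \<in> Z" if Z: "open Z" "Z \<noteq> {}" for Z
  proof -
    obtain z where "h z \<in> Z" using \<open>\<And>Z. open Z \<Longrightarrow> Z \<noteq> {} \<Longrightarrow> \<exists>z. h z \<in> Z\<close>[OF Z] by blast
    then show ?thesis by (intro exI[of _ "to_nat z"]) simp
  qed
  then show thesis by (rule that[of "\<lambda>m. h (from_nat m)"])
qed

text \<open>The remainder modulo \<open>N\<close> is the lowest digit; cancelling it and dividing by
  \<open>N\<close> leaves a shorter expansion.\<close>

lemma digits_unique:
  fixes d e :: "nat \<Rightarrow> nat"
  assumes "\<And>i. i < n \<Longrightarrow> d i < N" "\<And>i. i < n \<Longrightarrow> e i < N"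
    and "(\<Sum>i<n. d i * N ^ i) = (\<Sum>i<n. e i * N ^ i)" and "i < n"
  shows "d i = e i"
  using assms
proof (induction n arbitrary: d e i)
  case 0
  then show ?case by simp
next
  case (Suc n)
  have split: "(\<Sum>i<Suc n. f i * N ^ i) = f 0 + N * (\<Sum>i<n. f (Suc i) * N ^ i)" for f :: "nat \<Rightarrow> nat"
    by (simp add: sum.lessThan_Suc_shift sum_distrib_left mult.left_commute
             del: sum.lessThan_Suc)
  have lt: "d 0 < N" "e 0 < N" using Suc.prems by auto
  have eq: "d 0 + N * (\<Sum>i<n. d (Suc i) * N ^ i) = e 0 + N * (\<Sum>i<n. e (Suc i) * N ^ i)"
    using Suc.prems(3) unfolding split .
  have "d 0 = e 0"
    using arg_cong[OF eq, of "\<lambda>x. x mod N"] lt by simp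
  moreover have "(\<Sum>i<n. d (Suc i) * N ^ i) = (\<Sum>i<n. e (Suc i) * N ^ i)"
    using eq calculation lt by simp
  then have "d (Suc j) = e (Suc j)" if "j < n" for j
    using that by (intro Suc.IH[of "\<lambda>i. d (Suc i)" "\<lambda>i. e (Suc i)"] Suc.prems(1,2)) auto
  ultimately show ?case
    using Suc.prems(4) by (cases i) auto
qed

text \<open>Kronecker substitution: \<open>a i = x ^ N ^ i\<close> with \<open>N\<close> above all exponents turns distinct
  monomials into distinct powers of \<open>x\<close>.\<close>

lemma nonzero_mpoly_has_nonzero_value:
  assumes "poly_in_vars n P" "P \<noteq> 0"
  obtains a where "poly_at_funs P (\<lambda>i v. v i) a \<noteq> 0"
proof -
  let ?K = "Poly_Mapping.keys P"
  have "finite (\<Union>m\<in>?K. Poly_Mapping.lookup m ` Poly_Mapping.keys m)"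
    by auto
  then obtain N where N: "\<And>e. e \<in> (\<Union>m\<in>?K. Poly_Mapping.lookup m ` Poly_Mapping.keys m) \<Longrightarrow> e < N"
    using finite_nat_set_iff_bounded by metis
  \<comment> \<open>Taking \<open>Suc N\<close> as base makes the exponent 0 of an absent variable a
    valid digit even when \<open>N = 0\<close>.\<close>
  have bound: "Poly_Mapping.lookup m i < Suc N" if "m \<in> ?K" for m i
  proof (cases "i \<in> Poly_Mapping.keys m")
    case True
    then have "Poly_Mapping.lookup m i < N"
      using that by (intro N) blast
    then show ?thesis by simp
  next
    case False
    then show ?thesis by (simp add: in_keys_iff)
  qed
  define w where "w m = (\<Sum>i<n. Poly_Mapping.lookup m i * Suc N ^ i)" for m
  have sub: "Poly_Mapping.keys m \<subseteq> {..<n}" if "m \<in> ?K" for m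
    using assms(1) that by (simp add: poly_in_vars_def)
  have inj: "inj_on w ?K"
  proof (rule inj_onI)
    fix m m' assume m: "m \<in> ?K" "m' \<in> ?K" "w m = w m'"
    have "Poly_Mapping.lookup m i = Poly_Mapping.lookup m' i" for i
    proof (cases "i < n")
      case True
      then show ?thesis
        using digits_unique[of n "Poly_Mapping.lookup m" "Suc N" "Poly_Mapping.lookup m'" i] m bound
        unfolding w_def by blast
    next
      case False
      then show ?thesis using sub[OF m(1)] sub[OF m(2)]
        by (metis in_keys_iff lessThan_iff subsetD)
    qed
    then show "m = m'" by (rule poly_mapping_eqI)
  qed
  \<comment> \<open>The univariate polynomial after substitution. Since \<open>w\<close> is
    injective on the monomials of \<open>P\<close>, no two terms merge and no coefficient
    cancels.\<close>
  define Q where "Q = (\<Sum>m\<in>?K. monom (Poly_Mapping.lookup P m) (w m))"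
  obtain m0 where m0: "m0 \<in> ?K" using assms(2) by fastforce
  have "coeff Q (w m0) = (\<Sum>m\<in>?K. if m = m0 then Poly_Mapping.lookup P m else 0)"
    unfolding Q_def coeff_sum
    by (rule sum.cong) (use inj m0 in \<open>auto simp: inj_on_def\<close>)
  also have "\<dots> = Poly_Mapping.lookup P m0" using m0 by simp
  also have "\<dots> \<noteq> 0" using m0 by (simp add: in_keys_iff)
  finally have "Q \<noteq> 0" by auto
  then obtain x where x: "poly Q x \<noteq> 0" using poly_all_0_iff_0 by blast
  have "(\<Prod>i\<in>Poly_Mapping.keys m. (x ^ (Suc N ^ i)) ^ Poly_Mapping.lookup m i) = x ^ w m"
    if "m \<in> ?K" for m
  proof -
    have "(\<Prod>i\<in>Poly_Mapping.keys m. (x ^ (Suc N ^ i)) ^ Poly_Mapping.lookup m i)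
        = (\<Prod>i<n. (x ^ (Suc N ^ i)) ^ Poly_Mapping.lookup m i)"
      using sub[OF that] by (intro prod.mono_neutral_left) (auto simp: in_keys_iff)
    also have "\<dots> = (\<Prod>i<n. x ^ (Poly_Mapping.lookup m i * Suc N ^ i))"
      by (simp add: power_mult mult.commute flip: power_mult)
    finally show ?thesis by (simp add: w_def power_sum)
  qed
  then have "poly_at_funs P (\<lambda>i v. v i) (\<lambda>i. x ^ (Suc N ^ i)) = poly Q x"
    unfolding poly_at_funs_def Q_def poly_sum by (intro sum.cong) (auto simp: poly_monom)
  with x that show ?thesis by metis
qed


section \<open>The free algebra\<close>

text \<open>Reduces Borel sets of the whole space, possibly too many to enumerate along
  \<open>F\<close>, to Borel sets of the target of \<open>\<phi>\<close>. Open sets are handled by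
  continuity of \<open>\<psi>\<close>; complements and countable unions commute with
  preimages.\<close>

lemma borel_trace:
  fixes \<phi> :: "'a::topological_space \<Rightarrow> 'b::topological_space"
  assumes \<phi>: "homeomorphism F C \<phi> \<psi>" and N: "N \<in> sets borel"
  obtains B where "B \<in> sets borel" "F \<inter> N = F \<inter> \<phi> -` B"
proof -
  have "N \<in> sigma_sets UNIV {S. open S}"
    using N by (simp add: borel_def)
  then have "\<exists>B\<in>sigma_sets UNIV {S. open S}. F \<inter> N = F \<inter> \<phi> -` B"
  proof (induction rule: sigma_sets.induct)
    case (Basic A)
    then have "open A" by simp
    have "continuous_on C \<psi>" "\<psi> ` C \<subseteq> F" and \<phi>F: "\<phi> ` F \<subseteq> C" "\<And>x. x \<in> F \<Longrightarrow> \<psi> (\<phi> x) = x"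
      using \<phi> by (auto simp: homeomorphism_def)
    from continuous_on_open_invariant[THEN iffD1, OF this(1), rule_format, OF \<open>open A\<close>]
    obtain B where B: "open B" "B \<inter> C = \<psi> -` A \<inter> C" by blast
    have "x \<in> A \<longleftrightarrow> \<phi> x \<in> B" if "x \<in> F" for x
    proof -
      have "\<phi> x \<in> C" using that \<phi>F(1) by blast
      then have "\<phi> x \<in> B \<longleftrightarrow> \<psi> (\<phi> x) \<in> A" using B(2) by blast
      then show ?thesis using \<phi>F(2)[OF that] by simp
    qed
    then have "F \<inter> A = F \<inter> \<phi> -` B" by blast
    moreover have "B \<in> sigma_sets UNIV {S. open S}"
      using B(1) by (simp add: sigma_sets.Basic)
    ultimately show ?case by (rule bexI)
  next
    case Empty
    show ?case by (rule bexI[of _ "{}"]) (simp_all add: sigma_sets.Empty)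
  next
    case (Compl A)
    then obtain B where B: "B \<in> sigma_sets UNIV {S. open S}" "F \<inter> A = F \<inter> \<phi> -` B" by blast
    then have "F \<inter> (UNIV - A) = F \<inter> \<phi> -` (UNIV - B)" by blast
    then show ?case using sigma_sets.Compl[OF B(1)] by (rule bexI)
  next
    case (Union A)
    then have "\<forall>i. \<exists>B. B \<in> sigma_sets UNIV {S. open S} \<and> F \<inter> A i = F \<inter> \<phi> -` B" by blast
    then obtain B where B: "\<And>i. B i \<in> sigma_sets UNIV {S. open S}" "\<And>i. F \<inter> A i = F \<inter> \<phi> -` B i"
      by metis
    then have "F \<inter> (\<Union>i. A i) = F \<inter> \<phi> -` (\<Union>i. B i)" by blast
    then show ?case using sigma_sets.Union[OF B(1)] by (rule bexI)
  qed
  then obtain B where "B \<in> sigma_sets UNIV {S. open S}" "F \<inter> N = F \<inter> \<phi> -` B" by blast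
  then show ?thesis by (intro that[of B]) (simp_all add: borel_def)
qed

section \<open>Functions factoring through the diagonal map\<close>

text \<open>Isolates what the algebraic part needs: \<open>locally_constant_near\<close> supplies
  continuity points, \<open>diagonal\<close> defeats every Borel set \<open>N\<close> for every
  index \<open>m\<close>, and \<open>attained\<close> makes the dense values visible in the
  range.\<close>

locale diagonal_map =
  fixes G :: "'a::topological_space \<Rightarrow> nat set \<Rightarrow> real" and q :: "nat \<Rightarrow> nat set \<Rightarrow> real"
  assumes dense: "open Z \<Longrightarrow> Z \<noteq> {} \<Longrightarrow> \<exists>m. q m \<in> Z"
    and attained: "\<exists>x. G x = q m"
    and locally_constant_near:
      "open W \<Longrightarrow> x \<in> W \<Longrightarrow> open Z \<Longrightarrow> G x \<in> Z \<Longrightarrow>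
         \<exists>y\<in>W. G y \<in> Z \<and> (\<exists>U. open U \<and> y \<in> U \<and> (\<forall>z\<in>U. G z = G y))"
    and diagonal: "N \<in> sets borel \<Longrightarrow> \<exists>x. x \<in> N \<and> G x = (\<lambda>_. 0) \<or> x \<notin> N \<and> G x = q m"
begin

lemma super_quasi_continuous_comp:
  fixes p :: "(nat set \<Rightarrow> real) \<Rightarrow> real"
  assumes "continuous_on UNIV p"
  shows "super_quasi_continuous (\<lambda>x. p (G x))"
  unfolding super_quasi_continuous_def
proof (intro allI impI, elim conjE)
  fix x0 W V assume "open W" "x0 \<in> W" "open V" "p (G x0) \<in> V"
  then have "open (p -` V)" "G x0 \<in> p -` V"
    using open_vimage[OF _ assms] by auto
  from locally_constant_near[OF \<open>open W\<close> \<open>x0 \<in> W\<close> this]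
  obtain y U where y: "y \<in> W" "p (G y) \<in> V" and U: "open U" "y \<in> U" "\<forall>z\<in>U. G z = G y"
    by blast
  have "p (G z) = p (G y)" if "z \<in> U" for z
    using bspec[OF U(3) that] by simp
  with U(1,2) have "\<forall>\<^sub>F z in at y. p (G z) = p (G y)"
    unfolding eventually_at_topological by blast
  then have "y \<in> continuity_points (\<lambda>x. p (G x))"
    by (simp add: continuity_points_def tendsto_eventually)
  with y show "\<exists>x\<in>continuity_points (\<lambda>x. p (G x)) \<inter> W. p (G x) \<in> V" by blast
qed

lemma not_borel_measurable_comp:
  fixes p :: "(nat set \<Rightarrow> real) \<Rightarrow> real"
  assumes p: "continuous_on UNIV p" "p (\<lambda>_. 0) = 0" "p v \<noteq> 0"
  shows "(\<lambda>x. p (G x)) \<notin> borel_measurable borel"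
proof
  assume "(\<lambda>x. p (G x)) \<in> borel_measurable borel"
  then have N: "(\<lambda>x. p (G x)) -` (- {0}) \<in> sets borel"
    using measurable_sets[of "\<lambda>x. p (G x)" borel borel "- {0}"] by auto
  have "open (p -` (- {0}))"
    by (rule open_vimage[OF _ p(1)]) auto
  moreover have "v \<in> p -` (- {0})" using p(3) by simp
  ultimately obtain m where "q m \<in> p -` (- {0})" using dense by blast
  \<comment> \<open>The point obtained either lies in \<open>N\<close> although \<open>p\<close> is
    0 there, or lies outside \<open>N\<close> although \<open>p (q m)\<close> is nonzero.\<close>
  with diagonal[OF N, of m] p(2) show False by auto
qed

definition generator :: "nat set \<Rightarrow> 'a \<Rightarrow> real" where
  "generator \<alpha> = (\<lambda>x. G x \<alpha>)"

text \<open>Points of the power with different coordinates at \<open>\<alpha>\<close> and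
  \<open>\<beta>\<close> form a nonempty open set, so it contains some \<open>q m\<close>, a value
  of \<open>G\<close>.\<close>

lemma inj_generator: "inj generator"
proof (rule injI, rule ccontr)
  fix \<alpha> \<beta> assume eq: "generator \<alpha> = generator \<beta>" and "\<alpha> \<noteq> \<beta>"
  have "open {v :: nat set \<Rightarrow> real. v \<alpha> \<noteq> v \<beta>}"
    by (intro open_Collect_neq continuous_on_product_coordinates)
  moreover have "{v :: nat set \<Rightarrow> real. v \<alpha> \<noteq> v \<beta>} \<noteq> {}"
  proof -
    have "(\<lambda>\<gamma>. if \<gamma> = \<alpha> then 1 else 0) \<in> {v :: nat set \<Rightarrow> real. v \<alpha> \<noteq> v \<beta>}"
      using \<open>\<alpha> \<noteq> \<beta>\<close> by simp
    then show ?thesis by (metis empty_iff)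
  qed
  ultimately have "\<exists>m. q m \<in> {v. v \<alpha> \<noteq> v \<beta>}"
    by (rule dense)
  then obtain m where "q m \<alpha> \<noteq> q m \<beta>" by auto
  moreover obtain x where "G x = q m" using attained by blast
  ultimately show False
    using fun_cong[OF eq, of x] by (simp add: generator_def)
qed

text \<open>A polynomial in the generators is \<open>p \<circ> G\<close> for a continuous
  \<open>p\<close> vanishing at 0. If \<open>P\<close> is nonzero, so is \<open>p\<close> somewhere,
  and then \<open>p \<circ> G\<close> is not Borel, in particular not zero.\<close>

lemma free_generators_range: "free_generators (range generator)"
  unfolding free_generators_def
proof (intro allI impI iffI, elim conjE)
  fix n P f
  assume P: "poly_in_vars n P" "Poly_Mapping.lookup P 0 = 0"
    and f: "inj_on f {..<n}" "f ` {..<n} \<subseteq> range generator"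
    and zero: "poly_at_funs P f = (\<lambda>t. 0)"
  have "\<forall>i. \<exists>\<alpha>. i < n \<longrightarrow> f i = generator \<alpha>" using f(2) by blast
  then obtain \<alpha> where \<alpha>: "\<And>i. i < n \<Longrightarrow> f i = generator (\<alpha> i)" by metis
  have inj: "inj_on \<alpha> {..<n}"
    using f(1) \<alpha> by (metis inj_onCI inj_onD lessThan_iff)
  define p where "p v = poly_at_funs P (\<lambda>i v. v i) (\<lambda>i. v (\<alpha> i))" for v :: "nat set \<Rightarrow> real"
  have "i < n" if "m \<in> Poly_Mapping.keys P" "i \<in> Poly_Mapping.keys m" for m i
    using P(1) that by (auto simp: poly_in_vars_def)
  then have pG: "p (G x) = poly_at_funs P f x" for x
    unfolding p_def poly_at_funs_def
    by (intro sum.cong prod.cong arg_cong2[of _ _ _ _ "(*)"] refl) (simp add: \<alpha> generator_def)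
  have cont: "continuous_on UNIV p"
    unfolding p_def poly_at_funs_def
    by (intro continuous_intros continuous_on_product_coordinates)
  have p0: "p (\<lambda>_. 0) = 0"
    unfolding p_def poly_at_funs_def
  proof (intro sum.neutral ballI)
    fix m assume "m \<in> Poly_Mapping.keys P"
    with P(2) have "m \<noteq> 0" by (auto simp: in_keys_iff)
    then have "\<exists>i\<in>Poly_Mapping.keys m. Poly_Mapping.lookup m i \<noteq> 0"
      by (metis all_not_in_conv in_keys_iff keys_eq_empty)
    then show "Poly_Mapping.lookup P m * (\<Prod>i\<in>Poly_Mapping.keys m. 0 ^ Poly_Mapping.lookup m i) = 0"
      by auto
  qed
  show "P = 0"
  proof (rule ccontr)
    assume "P \<noteq> 0"
    then obtain a where a: "poly_at_funs P (\<lambda>i v. v i) a \<noteq> 0"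
      using nonzero_mpoly_has_nonzero_value[OF P(1)] by blast
    \<comment> \<open>Puts the value \<open>a i\<close> at coordinate \<open>\<alpha> i\<close>,
      consistently since \<open>\<alpha>\<close> is injective below \<open>n\<close>;
      \<open>p\<close> reads no other coordinates.\<close>
    define v where "v = a \<circ> the_inv_into {..<n} \<alpha>"
    have "v (\<alpha> i) = a i" if "i < n" for i
      using that inj by (simp add: v_def the_inv_into_f_f)
    with \<open>\<And>m i. m \<in> Poly_Mapping.keys P \<Longrightarrow> i \<in> Poly_Mapping.keys m \<Longrightarrow> i < n\<close>
    have "p v = poly_at_funs P (\<lambda>i v. v i) a"
      unfolding p_def poly_at_funs_def
      by (intro sum.cong prod.cong arg_cong2[of _ _ _ _ "(*)"] refl) simp
    with a have "p v \<noteq> 0" by simp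
    from not_borel_measurable_comp[OF cont p0 this] show False
      by (simp add: pG zero)
  qed
qed (simp add: poly_at_funs_def)

text \<open>The right-hand side is itself a subalgebra containing the generators, so members of the
  hull need not be written as polynomials.\<close>

lemma hull_subset_comp:
  "fun_subalgebra hull (range generator) \<subseteq>
     {\<lambda>x. p (G x) | p. continuous_on UNIV p \<and> p (\<lambda>_. 0) = 0}" (is "_ \<subseteq> ?T")
proof (rule hull_minimal)
  have T: "(\<lambda>x. p (G x)) \<in> ?T" if "continuous_on UNIV p" "p (\<lambda>_. 0) = 0" for p
    using that by blast
  show "range generator \<subseteq> ?T"
    using T[of "\<lambda>v. v _"] by (auto simp: generator_def)
  show "fun_subalgebra ?T"
    unfolding fun_subalgebra_def
  proof (intro conjI ballI allI)
    show "(\<lambda>x. 0) \<in> ?T" using T[of "\<lambda>_. 0"] by simp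
  next
    fix f g assume "f \<in> ?T" "g \<in> ?T"
    then obtain p r where "f = (\<lambda>x. p (G x))" "g = (\<lambda>x. r (G x))"
      and "continuous_on UNIV p" "p (\<lambda>_. 0) = 0" "continuous_on UNIV r" "r (\<lambda>_. 0) = 0"
      by blast
    then show "(\<lambda>x. f x + g x) \<in> ?T" "(\<lambda>x. f x * g x) \<in> ?T"
      using T[of "\<lambda>v. p v + r v"] T[of "\<lambda>v. p v * r v"]
      by (auto intro!: continuous_intros)
  next
    fix c f assume "f \<in> ?T"
    then obtain p where "f = (\<lambda>x. p (G x))" "continuous_on UNIV p" "p (\<lambda>_. 0) = 0"
      by blast
    then show "(\<lambda>x. c * f x) \<in> ?T"
      using T[of "\<lambda>v. c * p v"] by (auto intro!: continuous_intros)
  qed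
qed

lemma free_algebra:
  "\<exists>B :: ('a \<Rightarrow> real) set. generated_free_algebra (UNIV :: nat set set) B \<and>
     B \<subseteq> {f. f \<notin> borel_measurable borel \<and> super_quasi_continuous f} \<union> {\<lambda>x. 0}"
proof (intro exI conjI subsetI)
  have "range generator \<approx> (UNIV :: nat set set)"
    using inj_generator by (rule inj_on_image_eqpoll_self)
  then show "generated_free_algebra (UNIV :: nat set set) (fun_subalgebra hull (range generator))"
    using free_generators_range unfolding generated_free_algebra_def by blast
next
  fix f assume "f \<in> fun_subalgebra hull (range generator)"
  then obtain p where f: "f = (\<lambda>x. p (G x))" and p: "continuous_on UNIV p" "p (\<lambda>_. 0) = 0"
    using hull_subset_comp by blast
  show "f \<in> {f. f \<notin> borel_measurable borel \<and> super_quasi_continuous f} \<union> {\<lambda>x. 0}"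
  proof (cases "\<exists>v. p v \<noteq> 0")
    case True
    then show ?thesis
      using p not_borel_measurable_comp super_quasi_continuous_comp unfolding f by blast
  next
    case False
    then show ?thesis by (simp add: f)
  qed
qed

end

section \<open>Construction of the diagonal map\<close>

theorem theorem23:
  fixes F :: "'a::topological_space set"
  assumes "BP3' TYPE('a)"
    and "closed F" and "nowhere_dense F"
    and "F homeomorphic cantor_set"
  shows "\<exists>B :: ('a \<Rightarrow> real) set.
           generated_free_algebra (UNIV :: nat set set) B \<and>
           B \<subseteq> {f. f \<notin> borel_measurable borel \<and> super_quasi_continuous f} \<union> {\<lambda>x. 0}"
proof -
  obtain U :: "nat \<Rightarrow> 'a set" where disj: "disjoint_family U"
    and U: "\<And>m. open (U m)" "\<And>m. U m \<noteq> {}" "\<And>m. U m \<inter> F = {}" "\<And>m. F \<subseteq> closure (U m)"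
    and U0: "UNIV - (F \<union> (\<Union>m\<in>{0<..}. U m)) \<subseteq> closure (U 0)"
    using assms(1)[unfolded BP3'_def, rule_format, OF assms(3)] by blast
  obtain \<phi> \<psi> where \<phi>: "homeomorphism F cantor_set \<phi> \<psi>"
    using assms(4) unfolding homeomorphic_def by blast
  obtain q :: "nat \<Rightarrow> nat set \<Rightarrow> real" where q: "\<And>Z. open Z \<Longrightarrow> Z \<noteq> {} \<Longrightarrow> \<exists>m. q m \<in> Z"
    using separable_real_power_nat_sets by blast
  have "cantor_set = \<phi> ` F" using \<phi> by (simp add: homeomorphism_def)
  then have "cantor_set \<lesssim> F" by (auto simp: lepoll_iff)
  then have "sets (borel :: real measure) \<times> (UNIV :: nat set) \<lesssim> F"
    using borel_sets_times_nat_lepoll_nat_sets nat_sets_lepoll_cantor_set lepoll_trans by metis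
  \<comment> \<open>Attaches a Borel set and an index to points of \<open>F\<close> so that every
    such pair occurs.\<close>
  then obtain D :: "'a \<Rightarrow> real set \<times> nat" where D: "sets borel \<times> UNIV \<subseteq> D ` F"
    unfolding lepoll_iff by blast
  \<comment> \<open>The default 0 covers \<open>U 0\<close> together with all points outside every
    \<open>U m\<close> with \<open>m > 0\<close>.\<close>
  define k where "k x = (if \<exists>m>0. x \<in> U m then THE m. x \<in> U m else 0)" for x
  define G where "G x = (if x \<in> F then if \<phi> x \<in> fst (D x) then (\<lambda>_. 0) else q (snd (D x))
                         else q (k x))" for x
  have k: "k x = m" if "x \<in> U m" for x m
  proof -
    have "m' = m" if "x \<in> U m'" for m'
      using disj that \<open>x \<in> U m\<close> unfolding disjoint_family_on_def by blast
    then have "(THE m. x \<in> U m) = m" and "(\<exists>m>0. x \<in> U m) \<longleftrightarrow> m > 0"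
      using that by (blast intro: the_equality)+
    then show ?thesis by (simp add: k_def)
  qed
  have GU: "G x = q m" if "x \<in> U m" for x m
    using that U(3)[of m] k[OF that] by (auto simp: G_def)
  \<comment> \<open>If \<open>U m\<close> accumulates at \<open>x\<close>, then \<open>W\<close>
    meets \<open>U m\<close>, an open set on which \<open>G\<close> is constantly
    \<open>q m\<close>.\<close>
  have near: "\<exists>y\<in>W. G y \<in> Z \<and> (\<exists>U. open U \<and> y \<in> U \<and> (\<forall>z\<in>U. G z = G y))"
    if W: "open W" and m: "x \<in> closure (U m)" "x \<in> W" "q m \<in> Z" for W x Z m
  proof -
    obtain y where "y \<in> W" "y \<in> U m"
      using m W open_Int_closure_eq_empty[of W "U m"] by blast
    with GU m(3) U(1)[of m] show ?thesis by metis
  qed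
  interpret diagonal_map G q
  proof
    show "\<exists>m. q m \<in> Z" if "open Z" "Z \<noteq> {}" for Z using that by (rule q)
  next
    show "\<exists>x. G x = q m" for m using GU U(2)[of m] by blast
  next
    fix W x Z assume W: "open W" "x \<in> W" and Z: "open Z" "G x \<in> Z"
    show "\<exists>y\<in>W. G y \<in> Z \<and> (\<exists>U. open U \<and> y \<in> U \<and> (\<forall>z\<in>U. G z = G y))"
    proof (cases "x \<in> F")
      case True
      \<comment> \<open>On \<open>F\<close> every \<open>U m\<close> accumulates, so density of
        \<open>q\<close> allows an index to be chosen to suit \<open>Z\<close>, whatever
        \<open>G x\<close> is.\<close>
      obtain m where "q m \<in> Z" using Z q by blast
      with True U(4) W show ?thesis by (intro near) auto
    next
      case False
      \<comment> \<open>Off \<open>F\<close> the index is forced by \<open>G x = q (k x)\<close>;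
        condition (iii') handles the points outside every \<open>U m\<close>.\<close>
      have "x \<in> closure (U (k x))"
      proof (cases "\<exists>m>0. x \<in> U m")
        case True
        then show ?thesis using k closure_subset by blast
      next
        case none: False
        then have "x \<in> UNIV - (F \<union> (\<Union>m\<in>{0<..}. U m))" using False by blast
        then have "x \<in> closure (U 0)" using U0 by blast
        moreover have "k x = 0" using none unfolding k_def by (rule if_not_P)
        ultimately show ?thesis by simp
      qed
      moreover have "q (k x) \<in> Z" using False Z(2) by (simp add: G_def)
      ultimately show ?thesis using W by (intro near)
    qed
  next
    fix N :: "'a set" and m assume "N \<in> sets borel"
    then obtain B where B: "B \<in> sets borel" "F \<inter> N = F \<inter> \<phi> -` B"
      using borel_trace[OF \<phi>] by blast
    \<comment> \<open>At the point \<open>t\<close> carrying the pair \<open>(B, m)\<close>,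
      membership in \<open>N\<close> amounts to \<open>\<phi> t \<in> B\<close>, the very test that
      defines \<open>G t\<close>.\<close>
    then obtain t where t: "t \<in> F" "D t = (B, m)" using D by (metis UNIV_I imageE mem_Sigma_iff subsetD)
    then have "t \<in> N \<longleftrightarrow> \<phi> t \<in> B" using B(2) by blast
    then show "\<exists>x. x \<in> N \<and> G x = (\<lambda>_. 0) \<or> x \<notin> N \<and> G x = q m"
      using t by (intro exI[of _ t]) (auto simp: G_def)
  qed
  show ?thesis by (rule free_algebra)
qed

end
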